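(* Let $G$ be a maze, i.e. a finite connected planar graph embedded in the plane, with maximum degree at most three, together with three distinct vertices $A$, $B$, $C$ of degree one lying on the outer boundary. Run the probabilistic depth-first search (PDFS) on $G$ starting at $A$, with independent fair coin flips. Then the probability that $B$ is reached before $C$ and the probability that $C$ is reached before $B$ are both equal to $\tfrac12$. In other words, in PDFS the probabilities of exiting at $B$ and at $C$ are both $\tfrac12$.
   Context: Interpretation: vertices are "rooms" and edges are "doors". The vertex $A$ is the entrance, and $B$, $C$ are the two exits. (Concretely, a maze can be pictured as an $m\times n$ grid rectangle with some unit edges being walls; the boundary is walled except at three boundary edges $A,B,C$ in counterclockwise order, and two adjacent unit squares are joined by a door when no wall separates them.) Depth-first exploration. For the exploration, pretend that the exits are closed: the walker traverses the whole graph, passing through every door exactly twice (once in each direction), and returns to $A$. The walker starts at $A$ and walks through its unique door. The walker always remembers which doors it has already passed through. On arriving at a room $v$ through a door $e$, it acts as follows. - If $v$ was visited before, and it arrived through a door not previously used, it immediately goes back through $e$. - If this is the first visit to $v$, then $e$ becomes the entry door of $v$, and the walker next tries the other doors of $v$: - if $v$ has one door, it goes back through $e$; - if $v$ has two doors, it goes through the other door; - if $v$ has three doors, it must choose which of the two other doors to take first. - Whenever the walker is at $v$ after returning from a previously chosen door, it takes a door of $v$ that has not yet been passed through in either direction, if one exists. Otherwise it leaves $v$ through its entry door. The exploration ends when the walker returns to $A$ and all doors have been used. In the (right) depth-first search, the choice at a three-door room is always the door on the right relative to the entry door, in the planar embedding. The probabilistic depth-first search (PDFS) instead flips an independent fair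 coin the first time each three-door room is entered. On Heads it takes the door on the right of the entry door first; on Tails it takes the door on the left first. Exiting. The walk is said to exit at $B$ if $B$ is visited before $C$, and to exit at $C$ otherwise. *)

theory Defs
  imports "HOL-Analysis.Analysis" "HOL-Probability.Probability" "HOL-Probability.Product_PMF"
begin

text \<open>
  A plane graph has points of the plane as its vertices and arcs (as point sets) as its edges.
  Loops are excluded, parallel edges are allowed.
\<close>

locale plane_graph =
  fixes V :: "complex set" and E :: "complex set set"
  assumes finite_V: "finite V"
    and finite_E: "finite E"
    and edge_arc: "e \<in> E \<Longrightarrow>
      \<exists>g. arc g \<and> path_image g = e \<and> e \<inter> V = {pathstart g, pathfinish g}"
    and edges_meet: "\<lbrakk>e \<in> E; f \<in> E; e \<noteq> f\<rbrakk> \<Longrightarrow> e \<inter> f \<subseteq> V"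

definition doors :: "complex set set \<Rightarrow> complex \<Rightarrow> complex set set" where
  "doors E v = {e \<in> E. v \<in> e}"

definition other_end :: "complex set \<Rightarrow> complex set \<Rightarrow> complex \<Rightarrow> complex" where
  "other_end V e v = (THE w. w \<in> e \<inter> V \<and> w \<noteq> v)"

definition adjacency :: "complex set \<Rightarrow> complex set set \<Rightarrow> (complex \<times> complex) set" where
  "adjacency V E = {(u, v). u \<noteq> v \<and> (\<exists>e\<in>E. e \<inter> V = {u, v})}"

definition drawing :: "complex set \<Rightarrow> complex set set \<Rightarrow> complex set" where
  "drawing V E = V \<union> \<Union>E"

text \<open>The outer boundary is the frontier of the unbounded face.\<close>

definition outer_boundary :: "complex set \<Rightarrow> complex set set \<Rightarrow> complex set" where
  "outer_boundary V E = frontier (outside (drawing V E))"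

locale maze = plane_graph +
  fixes A B C :: complex
  assumes connected_graph: "u \<in> V \<Longrightarrow> v \<in> V \<Longrightarrow> (u, v) \<in> (adjacency V E)\<^sup>*"
    and max_degree: "v \<in> V \<Longrightarrow> card (doors E v) \<le> 3"
    and entrance_exits_in_V: "{A, B, C} \<subseteq> V"
    and entrance_exits_distinct: "distinct [A, B, C]"
    and entrance_exits_degree: "v \<in> {A, B, C} \<Longrightarrow> card (doors E v) = 1"
    and entrance_exits_outer: "{A, B, C} \<subseteq> outer_boundary V E"

text \<open>
  Cyclic order of the doors around a room \<open>v\<close>: follow each door from \<open>v\<close> until it first meets a
  small circle around \<open>v\<close>, and compare these points on the circle. Since the doors at \<open>v\<close> share
  no point of the closed disc other than \<open>v\<close>, the order does not depend on the radius
  as long as no other vertex lies in the closed disc.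
\<close>

definition door_radius :: "complex set \<Rightarrow> complex \<Rightarrow> real" where
  "door_radius V v = infdist v (V - {v}) / 2"

definition circle_point :: "complex set \<Rightarrow> complex \<Rightarrow> complex set \<Rightarrow> complex" where
  "circle_point V v e = (SOME p. \<exists>g. arc g \<and> path_image g \<subseteq> e \<and> pathstart g = v \<and>
     pathfinish g = p \<and> path_image g \<inter> sphere v (door_radius V v) = {p})"

text \<open>Counterclockwise orientation of the triangle \<open>p q s\<close>; for points of a circle this is
  their counterclockwise cyclic order.\<close>

definition ccw :: "complex \<Rightarrow> complex \<Rightarrow> complex \<Rightarrow> bool" where
  "ccw p q s \<longleftrightarrow> Im (cnj (q - p) * (s - p)) > 0"

definition ccw_doors ::
  "complex set \<Rightarrow> complex set set \<Rightarrow> complex \<Rightarrow> complex set \<Rightarrow> complex set \<Rightarrow> complex set \<Rightarrow> bool"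
where
  "ccw_doors V E v e f g \<longleftrightarrow> distinct [e, f, g] \<and> doors E v = {e, f, g} \<and>
     ccw (circle_point V v e) (circle_point V v f) (circle_point V v g)"

text \<open>
  Someone entering \<open>v\<close> through \<open>e\<close> has on the right the door that follows \<open>e\<close> counterclockwise
  (enter from the south: the order is south, east, north, west).
\<close>

definition right_door :: "complex set \<Rightarrow> complex set set \<Rightarrow> complex \<Rightarrow> complex set \<Rightarrow> complex set" where
  "right_door V E v e = (THE f. \<exists>g. ccw_doors V E v e f g)"

definition left_door :: "complex set \<Rightarrow> complex set set \<Rightarrow> complex \<Rightarrow> complex set \<Rightarrow> complex set" where
  "left_door V E v e = (THE g. \<exists>f. ccw_doors V E v e f g)"

text \<open>
  A history of the walk from \<open>A\<close> lists, latest first, the passages made so far, each as the door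
  passed through and the room thereby reached.
\<close>

type_synonym history = "(complex set \<times> complex) list"

definition used_doors :: "history \<Rightarrow> complex set set" where
  "used_doors h = fst ` set h"

definition visited_rooms :: "complex \<Rightarrow> history \<Rightarrow> complex set" where
  "visited_rooms A h = insert A (snd ` set h)"

definition current_room :: "complex \<Rightarrow> history \<Rightarrow> complex" where
  "current_room A h = (case h of [] \<Rightarrow> A | (e, v) # _ \<Rightarrow> v)"

definition entry_door :: "history \<Rightarrow> complex \<Rightarrow> complex set" where
  "entry_door h v = fst (last (filter (\<lambda>m. snd m = v) h))"

text \<open>
  The next door to take, given the outcomes of the coins of the rooms (\<open>True\<close> is Heads);
  \<open>None\<close> means that the exploration has ended. In the second equation, the passage \<open>(e, v)\<close> is
  the latest one, and \<open>h\<close> is the history before it. When the walker has returned to \<open>v\<close>, at most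
  one door of \<open>v\<close> is unused, as there are at most three.
\<close>

fun next_door ::
  "complex set \<Rightarrow> complex set set \<Rightarrow> complex \<Rightarrow> (complex \<Rightarrow> bool) \<Rightarrow> history \<Rightarrow> complex set option"
where
  "next_door V E A coin [] = Some (THE d. d \<in> doors E A)"
| "next_door V E A coin ((e, v) # h) =
    (if v \<notin> visited_rooms A h then
       Some (if card (doors E v) = 1 then e
             else if card (doors E v) = 2 then (THE d. d \<in> doors E v - {e})
             else if coin v then right_door V E v e
             else left_door V E v e)
     else if e \<notin> used_doors h then Some e
     else if doors E v - used_doors h \<noteq> {} then Some (SOME d. d \<in> doors E v - used_doors h)
     else if v = A then None
     else Some (entry_door h v))"

primrec pdfs ::
  "complex set \<Rightarrow> complex set set \<Rightarrow> complex \<Rightarrow> (complex \<Rightarrow> bool) \<Rightarrow> nat \<Rightarrow> history"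
where
  "pdfs V E A coin 0 = []"
| "pdfs V E A coin (Suc n) =
    (let h = pdfs V E A coin n in
     case next_door V E A coin h of
       None \<Rightarrow> h
     | Some d \<Rightarrow> (d, other_end V d (current_room A h)) # h)"

definition reached_before ::
  "complex set \<Rightarrow> complex set set \<Rightarrow> complex \<Rightarrow> (complex \<Rightarrow> bool) \<Rightarrow> complex \<Rightarrow> complex \<Rightarrow> bool"
where
  "reached_before V E A coin X Y \<longleftrightarrow>
    (\<exists>n. X \<in> visited_rooms A (pdfs V E A coin n) \<and> Y \<notin> visited_rooms A (pdfs V E A coin n))"

definition exit_of ::
  "complex set \<Rightarrow> complex set set \<Rightarrow> complex \<Rightarrow> complex \<Rightarrow> complex \<Rightarrow> (complex \<Rightarrow> bool) \<Rightarrow> complex"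
where
  "exit_of V E A B C coin = (if reached_before V E A coin B C then B else C)"

text \<open>
  Each three-door room has one coin, flipped when the room is first entered; the coins are
  independent and fair. (Other rooms get the irrelevant default \<open>False\<close>.)
\<close>

definition coin_flips :: "complex set \<Rightarrow> complex set set \<Rightarrow> (complex \<Rightarrow> bool) pmf" where
  "coin_flips V E =
    Pi_pmf {v \<in> V. card (doors E v) = 3} False (\<lambda>_. bernoulli_pmf (1 / 2))"

end

theory Submission
  imports Defs
begin

text \<open>
  Planarity matters only in that the right and the left door of a three-door room are its two
  doors other than the entry door. Consider the first moment at which \<open>B\<close> and \<open>C\<close> are no
  longer connected within the set of unvisited rooms. The walker has then just entered a new room
  \<open>v\<close>, and its two other doors lead to the components of \<open>B\<close> and of \<open>C\<close> among the unvisited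
  rooms. A depth-first search visits all of the component it enters before it backs out, so the
  coin of \<open>v\<close> decides the exit. Since the walk up to that moment does not use the coin of \<open>v\<close>,
  flipping it is an involution on the coin outcomes, and it swaps the exits.
\<close>

subsection \<open>Right and left doors\<close>

text \<open>Exchanging \<open>q\<close> and \<open>s\<close> negates the determinant behind
  \<open>ccw\<close>, so the claim amounts to its not vanishing: three distinct points of a circle
  are never collinear.\<close>

lemma ccw_swap:
  assumes "p \<in> sphere c r" "q \<in> sphere c r" "s \<in> sphere c r" "distinct [p, q, s]"
  shows "ccw p q s \<longleftrightarrow> \<not> ccw p s q"
proof -
  define u1 u2 a1 a2 b1 b2 where
    "u1 = Re (p - c)" and "u2 = Im (p - c)" and "a1 = Re (q - p)" and "a2 = Im (q - p)"
    and "b1 = Re (s - p)" and "b2 = Im (s - p)"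
  note defs = this
  have sq: "(Re (z - c))\<^sup>2 + (Im (z - c))\<^sup>2 = r\<^sup>2" if "z \<in> sphere c r" for z
    using that by (metis cmod_power2 dist_norm mem_sphere norm_minus_commute)
  \<comment> \<open>Expanding the circle equation of \<open>q\<close> around \<open>p\<close> and
    cancelling that of \<open>p\<close> leaves this relation; \<open>b\<close> is its analogue for
    \<open>s\<close>.\<close>
  have a: "2 * (u1 * a1 + u2 * a2) = - (a1\<^sup>2 + a2\<^sup>2)"
    using sq[OF assms(1)] sq[OF assms(2)] unfolding defs
    by (simp add: power2_eq_square algebra_simps)
  have b: "2 * (u1 * b1 + u2 * b2) = - (b1\<^sup>2 + b2\<^sup>2)"
    using sq[OF assms(1)] sq[OF assms(3)] unfolding defs
    by (simp add: power2_eq_square algebra_simps)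
  have "a1 * b2 - a2 * b1 \<noteq> 0"
  proof
    assume det: "a1 * b2 - a2 * b1 = 0"
    have ne: "a1 \<noteq> 0 \<or> a2 \<noteq> 0" "b1 \<noteq> 0 \<or> b2 \<noteq> 0" "a1 \<noteq> b1 \<or> a2 \<noteq> b2"
      using assms(4) unfolding defs by (auto simp: complex_eq_iff)
    obtain t where t: "b1 = t * a1" "b2 = t * a2"
    proof (cases "a1 = 0")
      case True
      then show ?thesis using det ne that[of "b2 / a2"] by auto
    next
      case False
      then show ?thesis using det that[of "b1 / a1"] by (auto simp: field_simps)
    qed
    \<comment> \<open>The line through \<open>p\<close> and \<open>q\<close> meets the circle only
      at the parameters 0 and 1, that is, at \<open>p\<close> and \<open>q\<close>
      themselves.\<close>
    have "t * - (a1\<^sup>2 + a2\<^sup>2) = - (t\<^sup>2 * (a1\<^sup>2 + a2\<^sup>2))"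
      using b unfolding t a[symmetric] by (simp add: algebra_simps power2_eq_square)
    then have "t * (t - 1) * (a1\<^sup>2 + a2\<^sup>2) = 0"
      by (simp add: algebra_simps power2_eq_square)
    then have "t = 0 \<or> t = 1"
      using ne(1) by auto
    then show False
      using ne t by auto
  qed
  then show ?thesis
    unfolding ccw_def defs by (auto simp: algebra_simps)
qed

context plane_graph
begin

lemma other_end_eq:
  assumes "e \<inter> V = {v, w}" "v \<noteq> w"
  shows "other_end V e v = w"
  unfolding other_end_def assms(1) by (rule the_equality) (use assms(2) in blast)+

lemma edge_arc_from:
  assumes "e \<in> doors E v" "v \<in> V"
  obtains g where "arc g" "path_image g = e" "pathstart g = v" "pathfinish g \<noteq> v"
    "e \<inter> V = {v, pathfinish g}"
proof -
  obtain g where g: "arc g" "path_image g = e" "e \<inter> V = {pathstart g, pathfinish g}"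
    using edge_arc assms by (auto simp: doors_def)
  have ne: "pathstart g \<noteq> pathfinish g"
    using arc_distinct_ends[OF g(1)] by metis
  have "v \<in> {pathstart g, pathfinish g}"
    using g(3) assms by (auto simp: doors_def)
  then consider "v = pathstart g" | "v = pathfinish g"
    by blast
  then show thesis
  proof cases
    case 1
    then show ?thesis using g ne that[of g] by auto
  next
    case 2
    then show ?thesis using g ne that[of "reversepath g"]
      by (auto simp: arc_reversepath insert_commute)
  qed
qed

lemma other_end_door:
  assumes "e \<in> doors E v" "v \<in> V"
  shows "other_end V e v \<in> V" "other_end V e v \<noteq> v" "e \<inter> V = {v, other_end V e v}"
    "e \<in> doors E (other_end V e v)"
proof -
  obtain w where w: "w \<noteq> v" "e \<inter> V = {v, w}"
    using edge_arc_from[OF assms] by metis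
  then have "other_end V e v = w"
    using other_end_eq by blast
  then show "other_end V e v \<in> V" "other_end V e v \<noteq> v" "e \<inter> V = {v, other_end V e v}"
    "e \<in> doors E (other_end V e v)"
    using w assms by (auto simp: doors_def)
qed

text \<open>A door at \<open>v\<close> provides a second vertex, so the distance is taken to a
  nonempty set. This set is finite, hence closed, and misses \<open>v\<close>; so the distance is
  positive and its half strictly smaller.\<close>

lemma door_radius:
  assumes "e \<in> doors E v" "v \<in> V"
  shows "door_radius V v > 0" "w \<in> V \<Longrightarrow> w \<noteq> v \<Longrightarrow> door_radius V v < dist v w"
proof -
  have ne: "V - {v} \<noteq> {}"
    using other_end_door[OF assms] by blast
  have "closed (V - {v})"
    using finite_V finite_imp_closed by blast
  then have "infdist v (V - {v}) \<noteq> 0"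
    using in_closed_iff_infdist_zero[OF _ ne] by blast
  then have pos: "infdist v (V - {v}) > 0"
    using infdist_nonneg[of v "V - {v}"] by linarith
  then show "door_radius V v > 0"
    by (simp add: door_radius_def)
  show "door_radius V v < dist v w" if "w \<in> V" "w \<noteq> v"
    using infdist_le[of w "V - {v}" v] that pos by (simp add: door_radius_def)
qed

text \<open>The choice in \<open>circle_point\<close> has a witness: the far end of the door lies
  outside the circle, so the arc, followed from \<open>v\<close>, has a first point on the
  circle.\<close>

lemma circle_point:
  assumes "e \<in> doors E v" "v \<in> V"
  shows "circle_point V v e \<in> e" "circle_point V v e \<in> sphere v (door_radius V v)"
proof -
  let ?r = "door_radius V v"
  obtain g where g: "arc g" "path_image g = e" "pathstart g = v" "pathfinish g \<noteq> v"
    "e \<inter> V = {v, pathfinish g}"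
    using edge_arc_from[OF assms] by metis
  have r: "?r > 0"
    using door_radius(1)[OF assms] .
  have "pathfinish g \<in> V"
    using g(5) by blast
  then have far: "?r < dist v (pathfinish g)"
    using door_radius(2)[OF assms] g(4) by blast
  obtain h where h: "path h" "pathstart h = pathstart g" "path_image h \<subseteq> path_image g"
      "path_image h - {pathfinish h} \<subseteq> interior (ball v ?r)"
      "pathfinish h \<in> frontier (ball v ?r)"
    using exists_path_subpath_to_frontier[of g "ball v ?r"] g r far
    by (auto simp: arc_imp_path)
  have fin: "pathfinish h \<in> sphere v ?r"
    using h(5) r by simp
  then have "pathstart h \<noteq> pathfinish h"
    using h(2) g(3) r by auto
  \<comment> \<open>The initial piece \<open>h\<close> is only known to be a path; an arc inside its
    image has the same ends and still meets the circle only at the last point.\<close>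
  then obtain k where k: "arc k" "path_image k \<subseteq> path_image h" "pathstart k = pathstart h"
      "pathfinish k = pathfinish h"
    using path_contains_arc[OF h(1) refl refl] by metis
  have "path_image h \<inter> sphere v ?r \<subseteq> {pathfinish h}"
    using h(4) by auto
  then have "path_image k \<inter> sphere v ?r = {pathfinish h}"
    using k fin pathfinish_in_path_image[of k] by auto
  then have "\<exists>p g. arc g \<and> path_image g \<subseteq> e \<and> pathstart g = v \<and>
     pathfinish g = p \<and> path_image g \<inter> sphere v ?r = {p}"
    using k h g by (metis order_trans)
  from someI_ex[OF this, folded circle_point_def]
  show "circle_point V v e \<in> e" "circle_point V v e \<in> sphere v ?r"
    by auto
qed

text \<open>Distinct doors meet only in vertices and the circle carries none, so their circle points
  differ. By \<open>ccw_swap\<close> exactly one order of the two other doors is counterclockwise,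
  which makes both descriptions unique.\<close>

lemma right_left_door:
  assumes v: "v \<in> V" and three: "card (doors E v) = 3" and e: "e \<in> doors E v"
  shows "right_door V E v e \<noteq> left_door V E v e"
    and "{right_door V E v e, left_door V E v e} = doors E v - {e}"
proof -
  have "card (doors E v - {e}) = 2"
    using three e by simp
  then obtain f g where fg: "doors E v - {e} = {f, g}" "f \<noteq> g"
    by (meson card_2_iff)
  have neq: "circle_point V v d \<noteq> circle_point V v d'"
    if "d \<in> doors E v" "d' \<in> doors E v" "d \<noteq> d'" for d d'
  proof
    assume eq: "circle_point V v d = circle_point V v d'"
    have "circle_point V v d \<in> d \<inter> d'"
      using circle_point(1)[OF that(1) v] circle_point(1)[OF that(2) v] eq by simp
    moreover have "d \<inter> d' \<subseteq> V"
      using edges_meet[of d d'] that by (simp add: doors_def)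
    ultimately have "circle_point V v d \<in> V"
      by blast
    moreover have "circle_point V v d \<in> sphere v (door_radius V v)"
      using circle_point(2)[OF that(1) v] .
    ultimately show False
      using door_radius[OF that(1) v] by (cases "circle_point V v d = v") fastforce+
  qed
  \<comment> \<open>Stated for arbitrary names of the two other doors, so that either
    counterclockwise order is an instance.\<close>
  have goal: "right_door V E v e \<noteq> left_door V E v e \<and>
      {right_door V E v e, left_door V E v e} = doors E v - {e}"
    if fg: "doors E v - {e} = {f, g}" "f \<noteq> g"
      and c: "ccw (circle_point V v e) (circle_point V v f) (circle_point V v g)" for f g
  proof -
    have D: "doors E v = {e, f, g}" "distinct [e, f, g]"
      using fg e by auto
    then have "\<not> ccw (circle_point V v e) (circle_point V v g) (circle_point V v f)"
      using ccw_swap[of "circle_point V v e" v "door_radius V v" "circle_point V v f"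
          "circle_point V v g"] c circle_point(2)[OF _ v] neq by auto
    moreover have "x = f \<and> y = g \<or> x = g \<and> y = f"
      if "distinct [e, x, y]" "doors E v = {e, x, y}" for x y
    proof -
      have "{x, y} = {f, g}"
        using that fg by auto
      then show ?thesis
        by (auto simp: doubleton_eq_iff)
    qed
    ultimately have iff: "ccw_doors V E v e x y \<longleftrightarrow> x = f \<and> y = g" for x y
      using c D unfolding ccw_doors_def by metis
    have "right_door V E v e = f" "left_door V E v e = g"
      unfolding right_door_def left_door_def iff by auto
    then show ?thesis using fg by auto
  qed
  have D: "doors E v = {e, f, g}" "distinct [e, f, g]"
    using fg e by auto
  have "ccw (circle_point V v e) (circle_point V v f) (circle_point V v g)
      \<or> ccw (circle_point V v e) (circle_point V v g) (circle_point V v f)"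
    using ccw_swap[of "circle_point V v e" v "door_radius V v" "circle_point V v f"
          "circle_point V v g"] circle_point(2)[OF _ v] neq D by auto
  then have "right_door V E v e \<noteq> left_door V E v e \<and>
      {right_door V E v e, left_door V E v e} = doors E v - {e}"
  proof
    assume "ccw (circle_point V v e) (circle_point V v f) (circle_point V v g)"
    then show ?thesis
      using goal[OF fg] by simp
  next
    assume "ccw (circle_point V v e) (circle_point V v g) (circle_point V v f)"
    moreover have "doors E v - {e} = {g, f}" "g \<noteq> f"
      using fg by (simp_all add: insert_commute)
    ultimately show ?thesis
      using goal[of g f] by simp
  qed
  then show "right_door V E v e \<noteq> left_door V E v e"
    "{right_door V E v e, left_door V E v e} = doors E v - {e}" by auto
qed

end

subsection \<open>The depth-first search stack\<close>

lemma visited_rooms_Nil [simp]: "visited_rooms A [] = {A}"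
  by (simp add: visited_rooms_def)

lemma visited_rooms_Cons [simp]: "visited_rooms A ((d, w) # h) = insert w (visited_rooms A h)"
  by (auto simp: visited_rooms_def)

lemma used_doors_Nil [simp]: "used_doors [] = {}"
  by (simp add: used_doors_def)

lemma used_doors_Cons [simp]: "used_doors ((d, w) # h) = insert d (used_doors h)"
  by (simp add: used_doors_def)

lemma current_room_Nil [simp]: "current_room A [] = A"
  by (simp add: current_room_def)

lemma current_room_Cons [simp]: "current_room A ((d, w) # h) = w"
  by (simp add: current_room_def)

lemma entry_door_Cons_new:
  "w \<notin> visited_rooms A h \<Longrightarrow> entry_door ((d, w) # h) w = d"
proof -
  assume "w \<notin> visited_rooms A h"
  then have "filter (\<lambda>m. snd m = w) h = []"
    by (auto simp: visited_rooms_def filter_empty_conv)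
  then show ?thesis
    by (simp add: entry_door_def)
qed

text \<open>Histories list the latest passage first, so \<open>last\<close> picks the earliest
  passage into \<open>u\<close>, which later ones cannot change. The room \<open>A\<close> counts as
  visited even without a passage into it, hence its exclusion.\<close>

lemma entry_door_Cons_old:
  "u \<in> visited_rooms A h \<Longrightarrow> u \<noteq> A \<Longrightarrow> entry_door ((d, w) # h) u = entry_door h u"
proof -
  assume "u \<in> visited_rooms A h" "u \<noteq> A"
  then have "filter (\<lambda>m. snd m = u) h \<noteq> []"
    by (auto simp: visited_rooms_def filter_empty_conv)
  then show ?thesis
    by (simp add: entry_door_def)
qed

text \<open>One step as a function of the history, so that moves can be analysed for histories not
  given in the form \<open>pdfs\<close>.\<close>

definition advance ::
  "complex set \<Rightarrow> complex set set \<Rightarrow> complex \<Rightarrow> (complex \<Rightarrow> bool) \<Rightarrow> history \<Rightarrow> history"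
where
  "advance V E A coin h = (case next_door V E A coin h of
       None \<Rightarrow> h
     | Some d \<Rightarrow> (d, other_end V d (current_room A h)) # h)"

lemma pdfs_Suc: "pdfs V E A coin (Suc n) = advance V E A coin (pdfs V E A coin n)"
  by (simp add: advance_def Let_def)

declare pdfs.simps(2) [simp del]

section \<open>Growth of the visited set, and coins of unvisited rooms\<close>

lemma visited_rooms_pdfs_mono:
  "m \<le> n \<Longrightarrow> visited_rooms A (pdfs V E A coin m) \<subseteq> visited_rooms A (pdfs V E A coin n)"
  by (induction n rule: dec_induct) (auto simp: pdfs_Suc advance_def split: option.splits)

text \<open>The visited sets form a chain, so the later of the two witnessing moments would already
  contain the room it is supposed to miss.\<close>

lemma not_reached_before_both:
  assumes "reached_before V E A coin X Y"
  shows "\<not> reached_before V E A coin Y X"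
proof
  assume "reached_before V E A coin Y X"
  then obtain m where m: "Y \<in> visited_rooms A (pdfs V E A coin m)"
      "X \<notin> visited_rooms A (pdfs V E A coin m)"
    by (auto simp: reached_before_def)
  obtain n where n: "X \<in> visited_rooms A (pdfs V E A coin n)"
      "Y \<notin> visited_rooms A (pdfs V E A coin n)"
    using assms by (auto simp: reached_before_def)
  show False
    using m n visited_rooms_pdfs_mono[of m n] visited_rooms_pdfs_mono[of n m]
    by (meson linorder_le_cases subsetD)
qed

text \<open>At most the coin of the current room is consulted, and that room is visited.\<close>

lemma next_door_flip:
  assumes "v \<notin> visited_rooms A h"
  shows "next_door V E A (coin(v := b)) h = next_door V E A coin h"
  using assms by (induction V E A coin h rule: next_door.induct) auto

text \<open>Agreement extends one passage beyond \<open>m\<close>: the passage that first enters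
  \<open>v\<close> is itself chosen without the coin of \<open>v\<close>.\<close>

lemma pdfs_flip:
  "v \<notin> visited_rooms A (pdfs V E A coin m) \<Longrightarrow>
    pdfs V E A (coin(v := b)) (Suc m) = pdfs V E A coin (Suc m)"
proof (induction m)
  case 0
  then show ?case
    by (simp add: pdfs_Suc advance_def)
next
  case (Suc m)
  have "v \<notin> visited_rooms A (pdfs V E A coin m)"
    using Suc.prems visited_rooms_pdfs_mono[OF le_SucI[OF order_refl]] by blast
  then have "pdfs V E A (coin(v := b)) (Suc m) = pdfs V E A coin (Suc m)"
    by (rule Suc.IH)
  then show ?case
    by (simp only: pdfs_Suc[of _ _ _ _ "Suc m"] advance_def next_door_flip[OF Suc.prems])
qed

text \<open>The parent relation of the depth-first search tree, with \<open>w\<close> the parent of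
  \<open>u\<close>; the root \<open>A\<close> has no parent.\<close>

definition entered_from :: "complex set \<Rightarrow> complex \<Rightarrow> history \<Rightarrow> complex \<Rightarrow> complex \<Rightarrow> bool" where
  "entered_from V A h u w \<longleftrightarrow>
     u \<noteq> A \<and> entry_door h u \<in> used_doors h \<and> entry_door h u \<inter> V = {u, w}"

text \<open>
  The stack \<open>s\<close> is the path of entry doors from the current room back to \<open>A\<close>; the rooms that
  have been visited but have left the stack are finished.
\<close>

definition dfs_stack :: "complex set \<Rightarrow> complex set set \<Rightarrow> complex \<Rightarrow> history \<Rightarrow> complex list \<Rightarrow> bool"
where
  "dfs_stack V E A h s \<longleftrightarrow>
     s \<noteq> [] \<and> distinct s \<and> last s = A \<and> set s \<subseteq> visited_rooms A h \<and>
     visited_rooms A h \<subseteq> V \<and> used_doors h \<subseteq> E \<and>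
     (\<forall>d\<in>used_doors h. d \<inter> V \<subseteq> visited_rooms A h) \<and>
     (\<forall>v\<in>visited_rooms A h - set s. doors E v \<subseteq> used_doors h) \<and>
     successively (entered_from V A h) s"

text \<open>The walker is free to go on and need not turn back: it came back through an old door, or
  it entered \<open>v\<close> for the first time. In the latter case no door of \<open>v\<close> had
  been used, so every door other than the entry door is still open to it.\<close>

definition at_top :: "complex set set \<Rightarrow> complex \<Rightarrow> history \<Rightarrow> complex \<Rightarrow> bool" where
  "at_top E A h v \<longleftrightarrow> current_room A h = v \<and>
     (\<forall>e h'. h = (e, v) # h' \<longrightarrow>
        (if v \<in> visited_rooms A h' then e \<in> used_doors h'
         else e \<in> doors E v \<and> doors E v \<inter> used_doors h' = {}))"

text \<open>
  The flag \<open>p\<close> marks the moments when the walker has just passed through a new door from the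
  top of the stack to a room visited before, and must turn back.
\<close>

definition dfs_state ::
  "complex set \<Rightarrow> complex set set \<Rightarrow> complex \<Rightarrow> history \<Rightarrow> complex list \<Rightarrow> bool \<Rightarrow> bool"
where
  "dfs_state V E A h s p \<longleftrightarrow> dfs_stack V E A h s \<and>
     (if p then \<exists>e w h'. h = (e, w) # h' \<and> e \<notin> used_doors h' \<and> w \<in> visited_rooms A h' \<and>
          w \<noteq> hd s \<and> e \<inter> V = {w, hd s}
      else at_top E A h (hd s))"

text \<open>A passage into a visited room leaves the visited set and all entry doors as they are,
  and the used doors can only grow. This serves probing, turning back and, once the top is removed,
  backing out.\<close>

lemma dfs_stack_revisit:
  assumes "dfs_stack V E A h s" "d \<in> E" "d \<inter> V \<subseteq> visited_rooms A h" "w \<in> visited_rooms A h"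
  shows "dfs_stack V E A ((d, w) # h) s"
proof -
  have "successively (entered_from V A h) s"
    using assms by (simp add: dfs_stack_def)
  then have "successively (entered_from V A ((d, w) # h)) s"
  proof (rule successively_mono)
    fix x y assume "x \<in> set s" "entered_from V A h x y"
    moreover have "x \<in> visited_rooms A h"
      using assms \<open>x \<in> set s\<close> by (auto simp: dfs_stack_def)
    ultimately show "entered_from V A ((d, w) # h) x y"
      by (auto simp: entered_from_def entry_door_Cons_old)
  qed
  then show ?thesis
    using assms by (auto simp: dfs_stack_def insert_absorb)
qed

context plane_graph
begin

text \<open>The new room goes on the stack at once, so the finished rooms stay the same, and its
  entry door \<open>d\<close> leads to the old top.\<close>

lemma dfs_stack_push:
  assumes "dfs_stack V E A h (u # s)" "d \<in> E" "d \<inter> V = {u, w}"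
    "w \<notin> visited_rooms A h"
  shows "dfs_stack V E A ((d, w) # h) (w # u # s)"
proof -
  have A: "A \<in> visited_rooms A h"
    by (simp add: visited_rooms_def)
  have "successively (entered_from V A h) (u # s)"
    using assms by (simp add: dfs_stack_def)
  then have "successively (entered_from V A ((d, w) # h)) (u # s)"
  proof (rule successively_mono)
    fix x y assume "x \<in> set (u # s)" "entered_from V A h x y"
    moreover have "x \<in> visited_rooms A h"
      using assms \<open>x \<in> set (u # s)\<close> unfolding dfs_stack_def by blast
    ultimately show "entered_from V A ((d, w) # h) x y"
      by (auto simp: entered_from_def entry_door_Cons_old)
  qed
  moreover have "entered_from V A ((d, w) # h) w u"
    using assms A by (auto simp: entered_from_def entry_door_Cons_new insert_commute)
  ultimately have "successively (entered_from V A ((d, w) # h)) (w # u # s)"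
    by simp
  moreover have "w \<in> V"
    using assms(3) by blast
  moreover have "distinct (w # u # s)" "last (w # u # s) = A"
      "set (w # u # s) \<subseteq> visited_rooms A ((d, w) # h)"
      "used_doors ((d, w) # h) \<subseteq> E"
    using assms(1,2,4) by (auto simp: dfs_stack_def)
  moreover have "visited_rooms A ((d, w) # h) \<subseteq> V"
    using assms(1) \<open>w \<in> V\<close> by (simp add: dfs_stack_def)
  moreover have "\<forall>e\<in>used_doors ((d, w) # h). e \<inter> V \<subseteq> visited_rooms A ((d, w) # h)"
  proof -
    have "u \<in> visited_rooms A h" "\<forall>e\<in>used_doors h. e \<inter> V \<subseteq> visited_rooms A h"
      using assms(1) by (simp_all add: dfs_stack_def)
    then show ?thesis
      using assms(3) by (simp add: subset_insertI2)
  qed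
  moreover have "\<forall>v\<in>visited_rooms A ((d, w) # h) - set (w # u # s).
      doors E v \<subseteq> used_doors ((d, w) # h)"
  proof -
    have "\<forall>v\<in>visited_rooms A h - set (u # s). doors E v \<subseteq> used_doors h"
      using assms(1) by (simp add: dfs_stack_def)
    then show ?thesis
      by (simp add: subset_insertI2)
  qed
  ultimately show ?thesis
    unfolding dfs_stack_def by blast
qed

end

section \<open>The possible moves of the walker\<close>

context maze
begin

lemma finite_doors: "finite (doors E v)"
  using finite_E by (simp add: doors_def)

lemma next_door_at_top:
  assumes st: "dfs_stack V E A h s" and top: "at_top E A h v" and v: "v = hd s"
  shows "doors E v \<subseteq> used_doors h \<Longrightarrow>
      next_door V E A coin h = (if v = A then None else Some (entry_door h v))"
    and "\<not> doors E v \<subseteq> used_doors h \<Longrightarrow>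
      \<exists>d \<in> doors E v - used_doors h. next_door V E A coin h = Some d"
proof -
  have *: "(doors E v \<subseteq> used_doors h \<longrightarrow>
      next_door V E A coin h = (if v = A then None else Some (entry_door h v))) \<and>
    (\<not> doors E v \<subseteq> used_doors h \<longrightarrow>
      (\<exists>d \<in> doors E v - used_doors h. next_door V E A coin h = Some d))"
  proof (cases h)
    case Nil
    then have "v = A"
      using top by (simp add: at_top_def)
    moreover obtain d where "doors E A = {d}"
      using entrance_exits_degree[of A] card_1_singletonE by blast
    ultimately show ?thesis
      using Nil by simp
  next
    case (Cons m h')
    then obtain e where h: "h = (e, v) # h'"
      using top by (cases m) (auto simp: at_top_def)
    show ?thesis
    proof (cases "v \<in> visited_rooms A h'")
      case True
      then have e: "e \<in> used_doors h'"
        using top h by (auto simp: at_top_def)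
      have "(SOME d. d \<in> doors E v - used_doors h') \<in> doors E v - used_doors h'"
        if "doors E v - used_doors h' \<noteq> {}"
        using that by (rule some_in_eq[THEN iffD2])
      then show ?thesis
        using True e h by (auto simp: insert_absorb entry_door_Cons_old)
    next
      case False
      have e: "e \<in> doors E v" "doors E v \<inter> used_doors h' = {}"
        using top h False by (auto simp: at_top_def)
      have "v \<in> V" and "v \<noteq> A"
        using st h False by (auto simp: dfs_stack_def visited_rooms_def)
      have onward: ?thesis
        if "d \<in> doors E v - {e}" "next_door V E A coin h = Some d" for d
      proof -
        have "d \<in> doors E v - used_doors h"
          using that(1) e h by auto
        then show ?thesis
          using that(2) by blast
      qed
      have "card (doors E v) \<noteq> 0"
        using e finite_doors by auto
      then consider "card (doors E v) = 1" | "card (doors E v) = 2" | "card (doors E v) = 3"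
        using max_degree[OF \<open>v \<in> V\<close>] by linarith
      then show ?thesis
      proof cases
        case 1
        then have "doors E v = {e}"
          using e by (metis card_1_singletonE singletonD)
        \<comment> \<open>In a dead end the door \<open>e\<close> is also the entry door, so turning
          back is the same as backing out.\<close>
        then show ?thesis
          using 1 h False \<open>v \<noteq> A\<close> by (simp add: entry_door_Cons_new)
      next
        case 2
        then have "card (doors E v - {e}) = 1"
          using e by simp
        then obtain d where d: "doors E v - {e} = {d}"
          by (rule card_1_singletonE)
        have "next_door V E A coin h = Some (THE d. d \<in> doors E v - {e})"
          using 2 h False by simp
        also have "\<dots> = Some d"
          unfolding d by simp
        finally show ?thesis
          using d by (intro onward) blast+
      next
        case 3
        let ?d = "if coin v then right_door V E v e else left_door V E v e"
        have "next_door V E A coin h = Some ?d"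
          using 3 h False by simp
        moreover have "?d \<in> {right_door V E v e, left_door V E v e}"
          by simp
        ultimately show ?thesis
          unfolding right_left_door(2)[OF \<open>v \<in> V\<close> 3 e(1)] by (intro onward)
      qed
    qed
  qed
  from * show "doors E v \<subseteq> used_doors h \<Longrightarrow>
      next_door V E A coin h = (if v = A then None else Some (entry_door h v))"
    "\<not> doors E v \<subseteq> used_doors h \<Longrightarrow>
      \<exists>d \<in> doors E v - used_doors h. next_door V E A coin h = Some d"
    by blast+
qed

text \<open>The case rule for inductions along the walk: \<open>push\<close> enters a new room,
  \<open>probe\<close> tries a new door and finds a visited room, \<open>turn\<close> returns from
  there, \<open>pop\<close> backs out to the parent, and \<open>finish\<close> rests at
  \<open>A\<close>.\<close>

lemma dfs_state_cases [consumes 1, case_names finish push probe turn pop]: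
  assumes "dfs_state V E A h s p"
  obtains "s = [A]" "\<not> p" "doors E A \<subseteq> used_doors h" "advance V E A coin h = h"
  | d w where "\<not> p" "next_door V E A coin h = Some d" "d \<in> doors E (hd s)" "d \<notin> used_doors h"
      "d \<inter> V = {hd s, w}" "w \<noteq> hd s" "w \<notin> visited_rooms A h"
      "advance V E A coin h = (d, w) # h" "dfs_state V E A ((d, w) # h) (w # s) False"
  | d w where "\<not> p" "d \<in> E" "d \<notin> used_doors h" "w \<in> visited_rooms A h"
      "advance V E A coin h = (d, w) # h" "dfs_state V E A ((d, w) # h) s True"
  | d where "p" "d \<in> used_doors h" "hd s \<in> visited_rooms A h"
      "advance V E A coin h = (d, hd s) # h" "dfs_state V E A ((d, hd s) # h) s False"
  | d u w s' where "\<not> p" "s = u # w # s'" "doors E u \<subseteq> used_doors h" "d \<in> used_doors h"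
      "w \<in> visited_rooms A h"
      "advance V E A coin h = (d, w) # h" "dfs_state V E A ((d, w) # h) (w # s') False"
proof -
  have st: "dfs_stack V E A h s"
    using assms by (simp add: dfs_state_def)
  have us: "used_doors h \<subseteq> E" "\<And>d. d \<in> used_doors h \<Longrightarrow> d \<inter> V \<subseteq> visited_rooms A h"
    and ne: "s \<noteq> []" and vis: "set s \<subseteq> visited_rooms A h" "visited_rooms A h \<subseteq> V"
    and lst: "last s = A" and dist: "distinct s"
    using st unfolding dfs_stack_def by auto
  have hd: "hd s \<in> visited_rooms A h" "hd s \<in> V"
    using ne vis hd_in_set by blast+
  show thesis
  proof (cases p)
    case True
    then obtain e w h' where h: "h = (e, w) # h'" "e \<notin> used_doors h'" "w \<in> visited_rooms A h'"
        "w \<noteq> hd s" "e \<inter> V = {w, hd s}"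
      using assms by (auto simp: dfs_state_def)
    then have "advance V E A coin h = (e, hd s) # h"
      using other_end_eq[of e w "hd s"] by (simp add: advance_def)
    moreover have "e \<in> used_doors h"
      using h by simp
    moreover have "dfs_state V E A ((e, hd s) # h) s False"
      using dfs_stack_revisit[OF st _ us(2) hd(1), of e] us(1) \<open>e \<in> used_doors h\<close> hd
      by (auto simp: dfs_state_def at_top_def)
    ultimately show ?thesis
      using that(4) True hd(1) by blast
  next
    case False
    then have top: "at_top E A h (hd s)"
      using assms by (simp add: dfs_state_def)
    then have cur: "current_room A h = hd s"
      by (simp add: at_top_def)
    note nxt = next_door_at_top[OF st top refl]
    show ?thesis
    proof (cases "doors E (hd s) \<subseteq> used_doors h")
      case all: True
      show ?thesis
      proof (cases "hd s = A")
        case True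
        then have "s = [A]"
          using ne dist lst by (cases s) (auto split: if_splits)
        moreover have "advance V E A coin h = h"
          using nxt(1)[OF all] True by (simp add: advance_def)
        ultimately show ?thesis
          using that(1) False all by simp
      next
        case nA: False
        \<comment> \<open>The stack ends in \<open>A\<close> but does not start with it, so a parent
          lies below the top.\<close>
        then obtain u w s' where s: "s = u # w # s'"
          using ne lst by (cases s rule: remdups_adj.cases) auto
        define d where "d = entry_door h u"
        have d: "d \<in> used_doors h" "d \<inter> V = {u, w}"
          using st s by (auto simp: dfs_stack_def entered_from_def d_def)
        have "u \<noteq> w"
          using dist s by auto
        have adv: "advance V E A coin h = (d, w) # h"
          using nxt(1)[OF all] nA s cur other_end_eq[OF d(2) \<open>u \<noteq> w\<close>]
          by (simp add: advance_def d_def)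
        have w: "w \<in> visited_rooms A h"
          using vis s by auto
        \<comment> \<open>The removed room \<open>u\<close> counts as finished because all its doors
          are used.\<close>
        have "dfs_stack V E A h (w # s')"
          using st all s unfolding dfs_stack_def by auto
        then have "dfs_state V E A ((d, w) # h) (w # s') False"
          using dfs_stack_revisit[of V E A h "w # s'" d w] us d w
          by (auto simp: dfs_state_def at_top_def)
        then show ?thesis
          using that(5)[of u w s' d] False s all d(1) w adv by simp
      qed
    next
      case new: False
      obtain d where d: "d \<in> doors E (hd s)" "d \<notin> used_doors h"
          "next_door V E A coin h = Some d"
        using nxt(2)[OF new] by blast
      define w where "w = other_end V d (hd s)"
      have w: "w \<in> V" "w \<noteq> hd s" "d \<inter> V = {hd s, w}" "d \<in> doors E w"
        using other_end_door[OF d(1) hd(2)] by (auto simp: w_def)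
      have dE: "d \<in> E"
        using d(1) by (simp add: doors_def)
      have adv: "advance V E A coin h = (d, w) # h"
        using d(3) cur by (simp add: advance_def w_def)
      show ?thesis
      proof (cases "w \<in> visited_rooms A h")
        case True
        then have "dfs_state V E A ((d, w) # h) s True"
          using dfs_stack_revisit[OF st dE _ True] w d hd
          by (auto simp: dfs_state_def)
        then show ?thesis
          using that(3)[OF False dE d(2) True adv] by simp
      next
        case wnew: False
        \<comment> \<open>Both ends of a used door are visited, while \<open>w\<close> is
          not.\<close>
        have "doors E w \<inter> used_doors h = {}"
          using us(2) w(1) wnew by (auto simp: doors_def)
        moreover have "dfs_stack V E A ((d, w) # h) (w # s)"
          using dfs_stack_push[of A h "hd s" "tl s" d w] st ne dE w wnew by simp
        ultimately have "dfs_state V E A ((d, w) # h) (w # s) False"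
          using w wnew by (auto simp: dfs_state_def at_top_def)
        then show ?thesis
          using that(2)[OF False d(3) d(1) d(2) w(3) w(2) wnew adv] by simp
      qed
    qed
  qed
qed

end

lemma pdfs_flip_le:
  assumes "v \<notin> visited_rooms A (pdfs V E A coin m)" "k \<le> Suc m"
  shows "pdfs V E A (coin(v := b)) k = pdfs V E A coin k"
proof (cases k)
  case (Suc j)
  then have "v \<notin> visited_rooms A (pdfs V E A coin j)"
    using assms visited_rooms_pdfs_mono[of j m A V E coin] by auto
  then show ?thesis
    using Suc pdfs_flip by blast
qed simp

section \<open>Paths within a set of rooms\<close>

lemma sym_adjacency: "sym (adjacency V E)"
  by (auto simp: sym_def adjacency_def insert_commute)

lemma rtrancl_Restr_adjacency_commute:
  "(u, v) \<in> (Restr (adjacency V E) U)\<^sup>* \<Longrightarrow> (v, u) \<in> (Restr (adjacency V E) U)\<^sup>*"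
proof -
  have "sym (Restr (adjacency V E) U)"
    using sym_adjacency[of V E] unfolding sym_def by blast
  then show "(u, v) \<in> (Restr (adjacency V E) U)\<^sup>* \<Longrightarrow> (v, u) \<in> (Restr (adjacency V E) U)\<^sup>*"
    using sym_rtrancl symD by metis
qed

lemma rtrancl_Restr_in:
  "(u, v) \<in> (Restr r U)\<^sup>* \<Longrightarrow> u \<noteq> v \<Longrightarrow> u \<in> U \<and> v \<in> U"
  by (metis IntE mem_Sigma_iff converse_rtranclE rtranclE)

text \<open>Every path from \<open>x\<close> to \<open>y\<close> in \<open>U\<close> passes through
  \<open>v\<close>; \<open>b\<close> is the room just before the first visit to
  \<open>v\<close>.\<close>

lemma rtrancl_Restr_cut_vertex:
  assumes "(x, y) \<in> (Restr r U)\<^sup>*" "x \<noteq> v" "y \<noteq> v" "(x, y) \<notin> (Restr r (U - {v}))\<^sup>*"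
  obtains b where "(b, v) \<in> r" "b \<in> U - {v}" "(x, b) \<in> (Restr r (U - {v}))\<^sup>*"
proof -
  have "(x, z) \<in> (Restr r (U - {v}))\<^sup>* \<or>
      (\<exists>b. (b, v) \<in> r \<and> b \<in> U - {v} \<and> (x, b) \<in> (Restr r (U - {v}))\<^sup>*)"
    if "(x, z) \<in> (Restr r U)\<^sup>*" for z
    using that
  proof (induction rule: rtrancl_induct)
    case base
    then show ?case by simp
  next
    case (step z z')
    show ?case
    proof (cases "(x, z) \<in> (Restr r (U - {v}))\<^sup>*")
      case xz: True
      then have "z \<noteq> v"
        using rtrancl_Restr_in[OF xz] assms(2) by auto
      show ?thesis
      proof (cases "z' = v")
        case True
        then show ?thesis
          using step(2) xz \<open>z \<noteq> v\<close> by blast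
      next
        case False
        then have "(z, z') \<in> Restr r (U - {v})"
          using step(2) \<open>z \<noteq> v\<close> by blast
        then show ?thesis
          using xz by (meson rtrancl.rtrancl_into_rtrancl)
      qed
    next
      case False
      then show ?thesis
        using step.IH by blast
    qed
  qed
  then show thesis
    using assms(1,4) that by blast
qed

context maze
begin

subsection \<open>Exploration of components\<close>

lemma dfs_state_pdfs: "\<exists>s p. dfs_state V E A (pdfs V E A coin n) s p"
proof (induction n)
  case 0
  have "dfs_state V E A [] [A] False"
    using entrance_exits_in_V by (auto simp: dfs_state_def dfs_stack_def at_top_def)
  then show ?case
    by auto
next
  case (Suc n)
  then obtain s p where st: "dfs_state V E A (pdfs V E A coin n) s p"
    by blast
  from dfs_state_cases[OF st, of coin] show ?case
    unfolding pdfs_Suc using st by cases metis+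
qed

lemma adjacent_visited:
  assumes "dfs_stack V E A h s" "doors E y \<subseteq> used_doors h" "(y, z) \<in> adjacency V E"
  shows "z \<in> visited_rooms A h"
proof -
  obtain e where e: "e \<in> E" "e \<inter> V = {y, z}"
    using assms(3) by (auto simp: adjacency_def)
  then have "e \<in> doors E y"
    by (auto simp: doors_def)
  then have "e \<inter> V \<subseteq> visited_rooms A h"
    using assms(1,2) unfolding dfs_stack_def by blast
  then show ?thesis
    using e by blast
qed

text \<open>With only \<open>A\<close> on the stack and its doors used up, every visited room is
  exhausted. So the visited set is closed under adjacency, and connectedness gives all of
  \<open>V\<close>.\<close>

lemma finished_visited_all:
  assumes st: "dfs_stack V E A h [A]" and all: "doors E A \<subseteq> used_doors h"
  shows "V \<subseteq> visited_rooms A h"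
proof
  fix v assume "v \<in> V"
  then have "(A, v) \<in> (adjacency V E)\<^sup>*"
    using connected_graph entrance_exits_in_V by simp
  then show "v \<in> visited_rooms A h"
  proof (induction rule: rtrancl_induct)
    case base
    then show ?case by (simp add: visited_rooms_def)
  next
    case (step y z)
    have "doors E y \<subseteq> used_doors h"
      using st all step.IH unfolding dfs_stack_def by (cases "y = A") auto
    then show ?case
      using adjacent_visited[OF st] step.hyps by blast
  qed
qed

lemma card_unused_less:
  assumes "d \<in> E" "d \<notin> used_doors h"
  shows "card (E - used_doors ((d, w) # h)) < card (E - used_doors h)"
proof -
  have "E - used_doors ((d, w) # h) \<subset> E - used_doors h"
    using assms by auto
  then show ?thesis
    using finite_E by (simp add: psubset_card_mono)
qed

text \<open>A decreasing measure forces the walk to reach \<open>finish\<close>, where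
  \<open>finished_visited_all\<close> applies.\<close>

lemma pdfs_visits_all: "\<exists>n. V \<subseteq> visited_rooms A (pdfs V E A coin n)"
proof -
  have "\<exists>m. V \<subseteq> visited_rooms A (pdfs V E A coin m)"
    if "dfs_state V E A (pdfs V E A coin n) s p" for n s p
    using that
  \<comment> \<open>A new door lowers the first term by 3, which outweighs the longer stack of
    \<open>push\<close> and the raised flag of \<open>probe\<close>; \<open>turn\<close> lowers the
    flag and \<open>pop\<close> shortens the stack.\<close>
  proof (induction "3 * card (E - used_doors (pdfs V E A coin n)) + length s + of_bool p"
      arbitrary: n s p rule: less_induct)
    case less
    note IH = less.hyps[of "Suc n", unfolded pdfs_Suc]
    from less.prems show ?case
    proof (cases rule: dfs_state_cases[where coin = coin])
      case finish
      then show ?thesis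
        using finished_visited_all less.prems by (auto simp: dfs_state_def)
    next
      case (push d w)
      have "d \<in> E"
        using push(3) by (simp add: doors_def)
      then show ?thesis
        using IH[of "w # s" False] push card_unused_less[of d "pdfs V E A coin n" w] by simp
    next
      case (probe d w)
      then show ?thesis
        using IH[of s True] card_unused_less[of d "pdfs V E A coin n" w] by simp
    next
      case (turn d)
      then show ?thesis
        using IH[of s False] by (simp add: insert_absorb)
    next
      case (pop d u w s')
      then show ?thesis
        using IH[of "w # s'" False] by (simp add: insert_absorb)
    qed
  qed
  then show ?thesis
    using dfs_state_pdfs by blast
qed

text \<open>
  When the walker backs out of \<open>x\<close>, all visited rooms of \<open>K\<close> have left the stack, so all their
  doors are used and their neighbours are visited; hence all of \<open>K\<close> is.
\<close>

lemma pdfs_explores_component: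
  assumes st: "dfs_state V E A (pdfs V E A coin k) (x # s0) False"
    and s0: "set s0 \<subseteq> W" and x: "x \<notin> W"
    and W: "visited_rooms A (pdfs V E A coin k) = insert x W"
    and K: "K = {y. (x, y) \<in> (Restr (adjacency V E) (V - W))\<^sup>*}"
    and "k \<le> n"
  shows "K \<subseteq> visited_rooms A (pdfs V E A coin n) \<or>
    (\<exists>ys p. dfs_state V E A (pdfs V E A coin n) (ys @ x # s0) p \<and> set ys \<subseteq> K \<and>
      visited_rooms A (pdfs V E A coin n) \<subseteq> W \<union> K)"
  using \<open>k \<le> n\<close>
proof (induction n rule: dec_induct)
  case base
  have "x \<in> K"
    by (simp add: K)
  then have "dfs_state V E A (pdfs V E A coin k) ([] @ x # s0) False \<and> set [] \<subseteq> K \<and>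
      visited_rooms A (pdfs V E A coin k) \<subseteq> W \<union> K"
    using st W by simp
  then show ?case
    by blast
next
  case (step n)
  let ?h = "pdfs V E A coin n"
  have "visited_rooms A (pdfs V E A coin k) \<subseteq> V"
    using st by (simp add: dfs_state_def dfs_stack_def)
  then have xV: "x \<in> V - W"
    using W x by blast
  then have KV: "K \<subseteq> V - W"
    unfolding K using rtrancl_Restr_in by fastforce
  have xK: "x \<in> K"
    by (simp add: K)
  show ?case
  proof (cases "K \<subseteq> visited_rooms A ?h")
    case True
    then show ?thesis
      using visited_rooms_pdfs_mono[of n "Suc n" A V E coin] by auto
  next
    case False
    then obtain ys p where ys: "dfs_state V E A ?h (ys @ x # s0) p" "set ys \<subseteq> K"
        "visited_rooms A ?h \<subseteq> W \<union> K"
      using step.IH by blast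
    from ys(1) show ?thesis
    proof (cases rule: dfs_state_cases[where coin = coin])
      case finish
      then have "pdfs V E A coin (Suc n) = ?h"
        by (simp add: pdfs_Suc)
      then show ?thesis
        using ys by metis
    next
      case (push d w)
      let ?u = "hd (ys @ x # s0)"
      have u: "?u \<in> K"
        using ys(2) xK by (cases ys) auto
      have "W \<subseteq> visited_rooms A ?h"
        using visited_rooms_pdfs_mono[OF step.hyps(1)] W by blast
      then have w: "w \<in> V - W"
        using push(5,7) by blast
      have "d \<in> E"
        using push(3) by (simp add: doors_def)
      then have "(?u, w) \<in> adjacency V E"
        using push(5,6) by (auto simp: adjacency_def)
      then have "(?u, w) \<in> Restr (adjacency V E) (V - W)"
        using u w KV by blast
      \<comment> \<open>The top of the stack lies in \<open>K\<close>, and \<open>w\<close> is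
        adjacent to it and outside \<open>W\<close>.\<close>
      then have "w \<in> K"
        using u unfolding K by (simp add: rtrancl.rtrancl_into_rtrancl)
      then have "dfs_state V E A (pdfs V E A coin (Suc n)) ((w # ys) @ x # s0) False \<and>
          set (w # ys) \<subseteq> K \<and> visited_rooms A (pdfs V E A coin (Suc n)) \<subseteq> W \<union> K"
        using push ys by (simp add: pdfs_Suc)
      then show ?thesis
        by blast
    next
      case (probe d w)
      then have "visited_rooms A (pdfs V E A coin (Suc n)) \<subseteq> W \<union> K"
        using ys by (auto simp: pdfs_Suc)
      then show ?thesis
        using probe ys by (metis pdfs_Suc)
    next
      case (turn d)
      then have "visited_rooms A (pdfs V E A coin (Suc n)) \<subseteq> W \<union> K"
        using ys by (auto simp: pdfs_Suc)
      then show ?thesis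
        using turn ys by (metis pdfs_Suc)
    next
      case (pop d u w s')
      have st': "dfs_state V E A (pdfs V E A coin (Suc n)) (w # s') False"
        using pop by (simp add: pdfs_Suc)
      show ?thesis
      \<comment> \<open>If \<open>ys\<close> is empty, the walker backs out of \<open>x\<close>
        itself and \<open>K\<close> must be complete; otherwise it only moves back within
        \<open>K\<close>.\<close>
      proof (cases ys)
        case Nil
        then have s': "w # s' = s0"
          using pop(2) by simp
        let ?h' = "pdfs V E A coin (Suc n)"
        have stk: "dfs_stack V E A ?h' s0"
          using st' s' by (simp add: dfs_state_def)
        have "K \<subseteq> visited_rooms A ?h'"
        proof
          fix y assume "y \<in> K"
          then have "(x, y) \<in> (Restr (adjacency V E) (V - W))\<^sup>*"
            by (simp add: K)
          then show "y \<in> visited_rooms A ?h'"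
          proof (induction rule: rtrancl_induct)
            case base
            have "x \<in> visited_rooms A (pdfs V E A coin k)"
              by (simp add: W)
            then show ?case
              using visited_rooms_pdfs_mono[of k "Suc n" A V E coin] step.hyps by auto
          next
            case (step y z)
            then have "y \<in> visited_rooms A ?h' - set s0"
              using s0 by blast
            then have "doors E y \<subseteq> used_doors ?h'"
              using stk unfolding dfs_stack_def by blast
            then show ?case
              using adjacent_visited[OF stk] step.hyps by blast
          qed
        qed
        then show ?thesis ..
      next
        case (Cons y ys')
        then have "w # s' = ys' @ x # s0"
          using pop(2) by simp
        moreover have "visited_rooms A (pdfs V E A coin (Suc n)) \<subseteq> W \<union> K"
          using pop ys by (auto simp: pdfs_Suc)
        moreover have "set ys' \<subseteq> K"
          using Cons ys(2) by simp
        ultimately show ?thesis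
          using st' by metis
      qed
    qed
  qed
qed

text \<open>Until \<open>X\<close> is first visited, \<open>pdfs_explores_component\<close> confines
  the walk to \<open>W\<close> and the component of \<open>x\<close>, which do not contain
  \<open>Y\<close>.\<close>

lemma reached_before_in_component:
  assumes st: "dfs_state V E A (pdfs V E A coin k) (x # s0) False"
    and s0: "set s0 \<subseteq> W" and x: "x \<notin> W"
    and W: "visited_rooms A (pdfs V E A coin k) = insert x W"
    and X: "X \<in> V" "(x, X) \<in> (Restr (adjacency V E) (V - W))\<^sup>*"
    and Y: "Y \<notin> W" "(x, Y) \<notin> (Restr (adjacency V E) (V - W))\<^sup>*"
  shows "reached_before V E A coin X Y"
proof -
  define n where "n = (LEAST n. X \<in> visited_rooms A (pdfs V E A coin n))"
  have nX: "X \<in> visited_rooms A (pdfs V E A coin n)"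
    unfolding n_def using pdfs_visits_all[of coin] X(1) by (metis LeastI subsetD)
  have below: "X \<notin> visited_rooms A (pdfs V E A coin j)" if "j < n" for j
    using that not_less_Least unfolding n_def by blast
  have "Y \<noteq> x" "Y \<noteq> X"
    using X Y by auto
  show ?thesis
  proof (cases "n \<le> k")
    case True
    then have "X \<in> visited_rooms A (pdfs V E A coin k)"
      using nX visited_rooms_pdfs_mono by blast
    moreover have "Y \<notin> visited_rooms A (pdfs V E A coin k)"
      using W Y(1) \<open>Y \<noteq> x\<close> by simp
    ultimately show ?thesis
      unfolding reached_before_def by blast
  next
    case False
    then obtain j where j: "n = Suc j" "k \<le> j"
      by (cases n) auto
    then have "X \<notin> visited_rooms A (pdfs V E A coin j)"
      using below by simp
    then have "visited_rooms A (pdfs V E A coin j) \<subseteq>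
        W \<union> {y. (x, y) \<in> (Restr (adjacency V E) (V - W))\<^sup>*}"
      using pdfs_explores_component[OF st s0 x W refl j(2)] X(2) by blast
    then have "Y \<notin> visited_rooms A (pdfs V E A coin j)"
      using Y by blast
    \<comment> \<open>The passage that reaches \<open>X\<close> adds at most one room, so it cannot
      add \<open>Y\<close> as well.\<close>
    moreover obtain z where "visited_rooms A (pdfs V E A coin n) \<subseteq>
        insert z (visited_rooms A (pdfs V E A coin j))"
      unfolding j(1) pdfs_Suc advance_def
      by (cases "next_door V E A coin (pdfs V E A coin j)") auto
    ultimately have "Y \<notin> visited_rooms A (pdfs V E A coin n)"
      using nX \<open>X \<notin> _\<close> \<open>Y \<noteq> X\<close> by blast
    then show ?thesis
      using nX unfolding reached_before_def by blast
  qed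
qed

subsection \<open>The decisive room\<close>

text \<open>Since \<open>B\<close> and \<open>C\<close> differ, they also count as separated once
  one of them is visited: no restricted path starts or ends there.\<close>

definition exits_separated :: "(complex \<Rightarrow> bool) \<Rightarrow> nat \<Rightarrow> bool" where
  "exits_separated coin n \<longleftrightarrow>
     (B, C) \<notin> (Restr (adjacency V E) (V - visited_rooms A (pdfs V E A coin n)))\<^sup>*"

text \<open>Approaching \<open>v\<close> from \<open>B\<close> and from \<open>C\<close> gives
  neighbours in different components of the rest; equal doors would have equal far ends and thus
  join the exits.\<close>

lemma separating_room_doors:
  assumes "(B, C) \<in> (Restr (adjacency V E) U)\<^sup>*" "B \<noteq> v" "C \<noteq> v"
    "(B, C) \<notin> (Restr (adjacency V E) (U - {v}))\<^sup>*"
  obtains e f b c where "e \<in> E" "e \<inter> V = {v, b}" "f \<in> E" "f \<inter> V = {v, c}" "e \<noteq> f"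
    "b \<in> U - {v}" "(b, B) \<in> (Restr (adjacency V E) (U - {v}))\<^sup>*"
    "c \<in> U - {v}" "(c, C) \<in> (Restr (adjacency V E) (U - {v}))\<^sup>*"
proof -
  obtain b where b: "(b, v) \<in> adjacency V E" "b \<in> U - {v}"
      "(B, b) \<in> (Restr (adjacency V E) (U - {v}))\<^sup>*"
    using rtrancl_Restr_cut_vertex[OF assms] by metis
  obtain c where c: "(c, v) \<in> adjacency V E" "c \<in> U - {v}"
      "(C, c) \<in> (Restr (adjacency V E) (U - {v}))\<^sup>*"
    using rtrancl_Restr_cut_vertex[of C B "adjacency V E" U v] assms
      rtrancl_Restr_adjacency_commute by metis
  obtain e where e: "e \<in> E" "e \<inter> V = {v, b}"
    using b(1) by (auto simp: adjacency_def insert_commute)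
  obtain f where f: "f \<in> E" "f \<inter> V = {v, c}"
    using c(1) by (auto simp: adjacency_def insert_commute)
  have "e \<noteq> f"
  proof
    assume "e = f"
    then have "b = c"
      using e(2) f(2) b(2) c(2) by (metis Diff_iff doubleton_eq_iff)
    then show False
      using assms(4) b(3) c(3) rtrancl_Restr_adjacency_commute by (metis rtrancl_trans)
  qed
  then show thesis
    using that e f b c rtrancl_Restr_adjacency_commute by metis
qed

text \<open>To separate the exits \<open>A\<close> would need two doors, but it has one.\<close>

lemma not_exits_separated_0: "\<not> exits_separated coin 0"
proof
  assume "exits_separated coin 0"
  then have sep: "(B, C) \<notin> (Restr (adjacency V E) (V - {A}))\<^sup>*"
    by (simp add: exits_separated_def)
  have "adjacency V E \<subseteq> V \<times> V"
    unfolding adjacency_def by blast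
  then have "Restr (adjacency V E) V = adjacency V E"
    by blast
  then have "(B, C) \<in> (Restr (adjacency V E) V)\<^sup>*"
    using connected_graph entrance_exits_in_V by simp
  moreover have "B \<noteq> A" "C \<noteq> A"
    using entrance_exits_distinct by auto
  ultimately obtain e f b c where "e \<in> E" "e \<inter> V = {A, b}" "f \<in> E" "f \<inter> V = {A, c}" "e \<noteq> f"
    using separating_room_doors sep by metis
  then have "e \<in> doors E A" "f \<in> doors E A" "e \<noteq> f"
    unfolding doors_def by blast+
  moreover have "card (doors E A) = 1"
    using entrance_exits_degree by simp
  ultimately show False
    by (metis card_1_singletonE singletonD)
qed

lemma exits_separated_eventually: "\<exists>n. exits_separated coin n"
proof -
  obtain n where "V \<subseteq> visited_rooms A (pdfs V E A coin n)"
    using pdfs_visits_all by blast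
  then have none: "V - visited_rooms A (pdfs V E A coin n) = {}"
    by blast
  have "exits_separated coin n"
    unfolding exits_separated_def none using entrance_exits_distinct by simp
  then show ?thesis ..
qed

text \<open>The only door of the leaf \<open>P\<close> leads to \<open>u\<close>, so every path
  leaving \<open>P\<close> continues at \<open>u\<close>. This shows that the room which separates
  the exits is not an exit.\<close>

lemma leaf_neighbour_in:
  assumes "(P, Q) \<in> (Restr (adjacency V E) U)\<^sup>*" "P \<noteq> Q" "card (doors E P) = 1"
    "d \<in> E" "d \<inter> V = {u, P}" "u \<noteq> P"
  shows "u \<in> U"
proof -
  obtain y where y: "(P, y) \<in> Restr (adjacency V E) U"
    using assms(1,2) by (meson converse_rtranclE)
  then obtain e where e: "e \<in> E" "e \<inter> V = {P, y}" "P \<noteq> y"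
    by (auto simp: adjacency_def)
  have "e \<in> doors E P" "d \<in> doors E P"
    using e assms(4,5) unfolding doors_def by blast+
  then have "e = d"
    using assms(3) by (metis card_1_singletonE singletonD)
  then have "u = y"
    using e(2,3) assms(5,6) by (metis doubleton_eq_iff)
  then show ?thesis
    using y by blast
qed

text \<open>Here \<open>X\<close> is the exit behind the right door of \<open>v\<close> and
  \<open>Y\<close> the one behind the left door. The last conclusion ranges over all coins with the
  same walk so far, so that it also covers the flipped outcome.\<close>

lemma decisive_room:
  assumes m: "\<not> exits_separated coin m" "exits_separated coin (Suc m)"
  obtains v X Y where
    "v = current_room A (pdfs V E A coin (Suc m))" "v \<in> V" "card (doors E v) = 3"
    "v \<notin> visited_rooms A (pdfs V E A coin m)" "X = B \<and> Y = C \<or> X = C \<and> Y = B"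
    "\<And>coin'. pdfs V E A coin' (Suc m) = pdfs V E A coin (Suc m) \<Longrightarrow>
       reached_before V E A coin' (if coin' v then X else Y) (if coin' v then Y else X)"
proof -
  let ?h = "pdfs V E A coin m"
  define U where "U = V - visited_rooms A ?h"
  obtain s p where st: "dfs_state V E A ?h s p"
    using dfs_state_pdfs by blast
  have conn: "(B, C) \<in> (Restr (adjacency V E) U)\<^sup>*"
    using m(1) by (simp add: exits_separated_def U_def)
  have BC: "B \<noteq> C"
    using entrance_exits_distinct by simp
  have BCU: "B \<in> U" "C \<in> U"
    using rtrancl_Restr_in[OF conn BC] by auto
  have change: "visited_rooms A (pdfs V E A coin (Suc m)) \<noteq> visited_rooms A ?h"
    using m by (auto simp: exits_separated_def)
  \<comment> \<open>The visited set has changed, and only \<open>push\<close> changes it.\<close>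
  obtain d w where d: "d \<in> E" "d \<in> doors E (hd s)"
      "d \<inter> V = {hd s, w}" "w \<noteq> hd s" "w \<notin> visited_rooms A ?h"
    and h1: "pdfs V E A coin (Suc m) = (d, w) # ?h"
    and st1: "dfs_state V E A ((d, w) # ?h) (w # s) False"
    using st
  proof (cases rule: dfs_state_cases[where coin = coin])
    case (push d w)
    then show ?thesis
      using that[of d w] by (simp add: pdfs_Suc doors_def)
  qed (use change in \<open>simp_all add: pdfs_Suc insert_absorb\<close>)
  have stk1: "dfs_stack V E A ((d, w) # ?h) (w # s)"
    using st1 by (simp add: dfs_state_def)
  have "s \<noteq> []" "set s \<subseteq> visited_rooms A ?h"
    using st by (simp_all add: dfs_state_def dfs_stack_def)
  then have hdU: "hd s \<notin> U"
    unfolding U_def using hd_in_set by blast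
  have U': "V - visited_rooms A ((d, w) # ?h) = U - {w}"
    by (auto simp: U_def)
  have sep: "(B, C) \<notin> (Restr (adjacency V E) (U - {w}))\<^sup>*"
    using m(2) unfolding exits_separated_def h1 U' .
  have deg: "card (doors E B) = 1" "card (doors E C) = 1"
    using entrance_exits_degree by simp_all
  \<comment> \<open>An exit still joined to the other one has an unvisited neighbour behind its only
    door, but the walker came from the visited room \<open>hd s\<close>.\<close>
  have "w \<noteq> B"
    using leaf_neighbour_in[OF conn BC deg(1) d(1)] d(3,4) hdU by blast
  moreover have "w \<noteq> C"
    using leaf_neighbour_in[OF rtrancl_Restr_adjacency_commute[OF conn] BC[symmetric] deg(2) d(1)]
      d(3,4) hdU by blast
  ultimately obtain e f b c where ef: "e \<in> E" "e \<inter> V = {w, b}" "f \<in> E" "f \<inter> V = {w, c}" "e \<noteq> f"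
    and b: "b \<in> U - {w}" "(b, B) \<in> (Restr (adjacency V E) (U - {w}))\<^sup>*"
    and c: "c \<in> U - {w}" "(c, C) \<in> (Restr (adjacency V E) (U - {w}))\<^sup>*"
    using separating_room_doors[OF conn _ _ sep] by metis
  have w: "w \<in> V"
    using d(3) by blast
  \<comment> \<open>The entry door leads back to a visited room, whereas \<open>e\<close> and
    \<open>f\<close> lead to unvisited ones; so \<open>w\<close> has three doors.\<close>
  have "d \<noteq> e" "d \<noteq> f"
    using d(3) ef b(1) c(1) hdU by (metis Diff_iff d(4) doubleton_eq_iff)+
  moreover have dw: "d \<in> doors E w" "e \<in> doors E w" "f \<in> doors E w"
    using d(1,3) ef unfolding doors_def by blast+
  ultimately have "card {d, e, f} = 3" "{d, e, f} \<subseteq> doors E w"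
    using ef(5) by simp_all
  then have dsw: "doors E w = {d, e, f}" and three: "card (doors E w) = 3"
    using max_degree[OF w] card_seteq[OF finite_doors] by metis+
  have rl: "{right_door V E w d, left_door V E w d} = {e, f}"
    using right_left_door(2)[OF w three dw(1)] dsw \<open>d \<noteq> e\<close> \<open>d \<noteq> f\<close> by (simp add: insert_Diff_if)
  have next_w: "next_door V E A coin' ((d, w) # ?h) =
      Some (if coin' w then right_door V E w d else left_door V E w d)" for coin'
    using d(5) three by simp
  \<comment> \<open>Both choices at \<open>w\<close> are treated at once: \<open>g\<close> leads to
    a new room \<open>x\<close> whose component among the remaining rooms contains \<open>P\<close>
    but not \<open>Q\<close>.\<close>
  have enter: "reached_before V E A coin' P Q"
    if g: "g \<inter> V = {w, x}" "x \<in> U - {w}" "next_door V E A coin' ((d, w) # ?h) = Some g"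
      and coin': "pdfs V E A coin' (Suc m) = (d, w) # ?h"
      and PQ: "(x, P) \<in> (Restr (adjacency V E) (U - {w}))\<^sup>*"
        "(x, Q) \<notin> (Restr (adjacency V E) (U - {w}))\<^sup>*" "P \<in> U" "Q \<in> U - {w}"
    for coin' g x P Q
  proof -
    have "w \<noteq> x"
      using g(2) by blast
    then have adv: "advance V E A coin' ((d, w) # ?h) = (g, x) # (d, w) # ?h"
      using g(3) other_end_eq[OF g(1)] by (simp add: advance_def)
    have xnew: "x \<notin> visited_rooms A ((d, w) # ?h)"
      using g(2) by (simp add: U_def)
    have gnew: "g \<notin> used_doors ((d, w) # ?h)"
      using stk1 xnew g(1) unfolding dfs_stack_def by blast
    have "dfs_state V E A ((g, x) # (d, w) # ?h) (x # w # s) False"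
      using st1
    proof (cases rule: dfs_state_cases[where coin = coin'])
      case finish
      then show ?thesis
        using adv by simp
    next
      case (push d' w')
      then show ?thesis
        using adv by simp
    next
      case (probe d' w')
      then show ?thesis
        using adv xnew by simp
    next
      case (pop d' u w' s')
      then show ?thesis
        using adv gnew by simp
    qed simp
    moreover have "pdfs V E A coin' (Suc (Suc m)) = (g, x) # (d, w) # ?h"
      using coin' adv by (simp add: pdfs_Suc[of _ _ _ _ "Suc m"])
    moreover have "set (w # s) \<subseteq> visited_rooms A ((d, w) # ?h)"
      using stk1 by (simp add: dfs_stack_def)
    ultimately show ?thesis
      using reached_before_in_component[of coin' "Suc (Suc m)" x "w # s"
          "visited_rooms A ((d, w) # ?h)" P Q] xnew PQ unfolding U'
      by (simp add: U_def)
  qed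
  have BU: "B \<in> U - {w}" "C \<in> U - {w}"
    using BCU \<open>w \<noteq> B\<close> \<open>w \<noteq> C\<close> by auto
  have nb: "(b, C) \<notin> (Restr (adjacency V E) (U - {w}))\<^sup>*"
    using sep b(2) rtrancl_Restr_adjacency_commute by (metis rtrancl_trans)
  have nc: "(c, B) \<notin> (Restr (adjacency V E) (U - {w}))\<^sup>*"
    using sep c(2) rtrancl_Restr_adjacency_commute by (metis rtrancl_trans)
  have enter_e: "reached_before V E A coin' B C"
    if "next_door V E A coin' ((d, w) # ?h) = Some e" "pdfs V E A coin' (Suc m) = (d, w) # ?h"
    for coin'
    using enter[OF ef(2) b(1) that b(2) nb BCU(1) BU(2)] .
  have enter_f: "reached_before V E A coin' C B"
    if "next_door V E A coin' ((d, w) # ?h) = Some f" "pdfs V E A coin' (Suc m) = (d, w) # ?h"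
    for coin'
    using enter[OF ef(4) c(1) that c(2) nc BCU(2) BU(1)] .
  have cur: "w = current_room A (pdfs V E A coin (Suc m))"
    by (simp add: h1)
  from rl consider "right_door V E w d = e" "left_door V E w d = f"
    | "right_door V E w d = f" "left_door V E w d = e"
    by (metis doubleton_eq_iff)
  then show thesis
  proof cases
    case 1
    then have "reached_before V E A coin' (if coin' w then B else C) (if coin' w then C else B)"
      if "pdfs V E A coin' (Suc m) = pdfs V E A coin (Suc m)" for coin'
      using enter_e[of coin'] enter_f[of coin'] next_w[of coin'] that h1 by (cases "coin' w") simp_all
    then show ?thesis
      using that[OF cur w three d(5), of B C] by blast
  next
    case 2
    then have "reached_before V E A coin' (if coin' w then C else B) (if coin' w then B else C)"
      if "pdfs V E A coin' (Suc m) = pdfs V E A coin (Suc m)" for coin'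
      using enter_e[of coin'] enter_f[of coin'] next_w[of coin'] that h1 by (cases "coin' w") simp_all
    then show ?thesis
      using that[OF cur w three d(5), of C B] by blast
  qed
qed

section \<open>The involution on coin outcomes and the counting argument\<close>

definition first_separation :: "(complex \<Rightarrow> bool) \<Rightarrow> nat" where
  "first_separation coin = (LEAST n. exits_separated coin n)"

definition flip_decisive :: "(complex \<Rightarrow> bool) \<Rightarrow> complex \<Rightarrow> bool" where
  "flip_decisive coin =
     (let v = current_room A (pdfs V E A coin (first_separation coin)) in coin(v := \<not> coin v))"

text \<open>The walk up to the first separation ignores the coin of the decisive room. Hence the
  flipped outcome has the same separation moment and the same decisive room, and there it takes the
  other door.\<close>

lemma flip_decisive:
  shows "flip_decisive (flip_decisive coin) = coin"
    and "\<exists>v\<in>V. card (doors E v) = 3 \<and> flip_decisive coin = coin(v := \<not> coin v)"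
    and "reached_before V E A coin B C \<longleftrightarrow> reached_before V E A (flip_decisive coin) C B"
    and "reached_before V E A coin B C \<or> reached_before V E A coin C B"
proof -
  have sep: "exits_separated coin (first_separation coin)"
    unfolding first_separation_def using exits_separated_eventually by (metis LeastI)
  \<comment> \<open>Separation does not hold at the start, so a last unseparated moment
    \<open>m\<close> exists.\<close>
  then obtain m where m: "first_separation coin = Suc m"
    using not_exits_separated_0 by (cases "first_separation coin") auto
  have before: "\<not> exits_separated coin k" if "k \<le> m" for k
    using not_less_Least[of k "exits_separated coin"] that m by (simp add: first_separation_def)
  obtain v X Y where
    v: "v = current_room A (pdfs V E A coin (Suc m))" "v \<in> V" "card (doors E v) = 3"
      "v \<notin> visited_rooms A (pdfs V E A coin m)"
    and XY: "X = B \<and> Y = C \<or> X = C \<and> Y = B"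
    and reach: "\<And>coin'. pdfs V E A coin' (Suc m) = pdfs V E A coin (Suc m) \<Longrightarrow>
       reached_before V E A coin' (if coin' v then X else Y) (if coin' v then Y else X)"
    using decisive_room[of coin m] before[of m] sep m by (metis order_refl)
  define coin' where "coin' = coin(v := \<not> coin v)"
  have fl: "flip_decisive coin = coin'"
    by (simp add: flip_decisive_def m v(1)[symmetric] coin'_def)
  have same: "pdfs V E A coin' k = pdfs V E A coin k" if "k \<le> Suc m" for k
    unfolding coin'_def using pdfs_flip_le[OF v(4) that] .
  have "first_separation coin' = Suc m"
    unfolding first_separation_def
  proof (rule Least_equality)
    show "exits_separated coin' (Suc m)"
      using sep m same[of "Suc m"] by (simp add: exits_separated_def)
    show "Suc m \<le> k" if "exits_separated coin' k" for k
    proof (rule ccontr)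
      assume "\<not> Suc m \<le> k"
      then have "k \<le> m"
        by simp
      then show False
        using that before[of k] same[of k] by (simp add: exits_separated_def)
    qed
  qed
  then have "flip_decisive coin' = coin"
    using same[of "Suc m"] v(1) by (simp add: flip_decisive_def coin'_def)
  then show "flip_decisive (flip_decisive coin) = coin"
    by (simp add: fl)
  show "\<exists>v\<in>V. card (doors E v) = 3 \<and> flip_decisive coin = coin(v := \<not> coin v)"
    using v(2,3) fl coin'_def by blast
  have r: "reached_before V E A coin (if coin v then X else Y) (if coin v then Y else X)"
    using reach[OF refl] .
  have r': "reached_before V E A coin' (if coin v then Y else X) (if coin v then X else Y)"
    using reach[OF same[OF order_refl]] by (cases "coin v") (simp_all add: coin'_def)
  show "reached_before V E A coin B C \<or> reached_before V E A coin C B"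
    using r XY by (auto split: if_splits)
  show "reached_before V E A coin B C \<longleftrightarrow> reached_before V E A (flip_decisive coin) C B"
    unfolding fl using r r' XY not_reached_before_both by (cases "coin v") auto
qed

text \<open>The coins are uniform on the finite set \<open>S\<close>, which splits into
  \<open>SB\<close> and \<open>SC\<close>; \<open>flip_decisive\<close> is a bijection between the
  two parts.\<close>

lemma prob_reached_before_half:
  "measure_pmf.prob (coin_flips V E) {coin. reached_before V E A coin B C} = 1 / 2"
  "measure_pmf.prob (coin_flips V E) {coin. reached_before V E A coin C B} = 1 / 2"
proof -
  let ?T = "{v \<in> V. card (doors E v) = 3}"
  define S where "S = PiE_dflt ?T False (\<lambda>_. UNIV :: bool set)"
  define SB where "SB = {coin \<in> S. reached_before V E A coin B C}"
  define SC where "SC = {coin \<in> S. reached_before V E A coin C B}"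
  have fin: "finite S"
    unfolding S_def using finite_V by (intro finite_PiE_dflt) auto
  have ne: "S \<noteq> {}"
    unfolding S_def by (auto simp: PiE_dflt_def)
  have coins: "coin_flips V E = pmf_of_set S"
    unfolding coin_flips_def bernoulli_pmf_half_conv_pmf_of_set S_def
    using finite_V by (intro Pi_pmf_of_set) auto
  \<comment> \<open>Only the coin of a three-door room is flipped, so the default
    \<open>False\<close> elsewhere is preserved.\<close>
  have flipS: "flip_decisive coin \<in> S" if "coin \<in> S" for coin
    using flip_decisive(2)[of coin] that by (auto simp: S_def PiE_dflt_def split: if_splits)
  have swap: "reached_before V E A (flip_decisive coin) B C" if "reached_before V E A coin C B" for coin
    using flip_decisive(3)[of "flip_decisive coin"] that by (simp add: flip_decisive(1))
  have "bij_betw flip_decisive SB SC"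
  proof (rule bij_betwI[where g = flip_decisive])
    show "flip_decisive \<in> SB \<rightarrow> SC"
      using flipS flip_decisive(3) by (auto simp: SB_def SC_def)
    show "flip_decisive \<in> SC \<rightarrow> SB"
      using flipS swap by (auto simp: SB_def SC_def)
  qed (simp_all add: flip_decisive(1))
  then have "card SB = card SC"
    by (rule bij_betw_same_card)
  moreover have "SB \<union> SC = S" "SB \<inter> SC = {}"
    using flip_decisive(4) not_reached_before_both by (auto simp: SB_def SC_def)
  then have "card S = card SB + card SC"
    using fin by (metis card_Un_disjoint finite_Un)
  ultimately have half: "card S = 2 * card SB" "card S = 2 * card SC"
    by simp_all
  have pos: "card S > 0"
    using fin ne by (simp add: card_gt_0_iff)
  have "S \<inter> {coin. reached_before V E A coin B C} = SB" "S \<inter> {coin. reached_before V E A coin C B} = SC"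
    by (auto simp: SB_def SC_def)
  then show "measure_pmf.prob (coin_flips V E) {coin. reached_before V E A coin B C} = 1 / 2"
    "measure_pmf.prob (coin_flips V E) {coin. reached_before V E A coin C B} = 1 / 2"
    unfolding coins measure_pmf_of_set[OF ne fin] using half pos by auto
qed

end

theorem mainTheorem1:
  fixes V :: "complex set" and E :: "complex set set" and A B C :: complex
  assumes "maze V E A B C"
  shows "measure_pmf.prob (coin_flips V E) {coin. reached_before V E A coin B C} = 1 / 2
       \<and> measure_pmf.prob (coin_flips V E) {coin. reached_before V E A coin C B} = 1 / 2
       \<and> measure_pmf.prob (coin_flips V E) {coin. exit_of V E A B C coin = B} = 1 / 2
       \<and> measure_pmf.prob (coin_flips V E) {coin. exit_of V E A B C coin = C} = 1 / 2"
proof -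
  interpret maze V E A B C
    by (rule assms)
  have "B \<noteq> C"
    using entrance_exits_distinct by simp
  then have "{coin. exit_of V E A B C coin = B} = {coin. reached_before V E A coin B C}"
    by (auto simp: exit_of_def)
  \<comment> \<open>Exiting at \<open>C\<close> is defined as not reaching \<open>B\<close> first;
    since one exit is always reached before the other, this means reaching \<open>C\<close>
    first.\<close>
  moreover have "{coin. exit_of V E A B C coin = C} = {coin. reached_before V E A coin C B}"
    using \<open>B \<noteq> C\<close> flip_decisive(4) not_reached_before_both by (auto simp: exit_of_def)
  ultimately show ?thesis
    using prob_reached_before_half by simp
qed

end
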